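(* In the dyadic simulation tree described in the context, assume that the random objects $S^0_0,\ (C^0_i)_{0\le i<1},\ (C^1_i)_{0\le i<2},\ \dots,\ (C^{m-1}_i)_{0\le i<2^{m-1}}$ are mutually independent, and that for each level $l$ the family $(C^l_i)_{0\le i<2^l}$ is $2$-wise (pairwise) independent. Then for any integers $a,b$ with $0\le a\le b<U$, the range-sum $S[a,b)=\sum_{i=a}^{b-1}X_i$ has marginal distribution $X^{*(b-a)}$.
   Context: Let $m\ge1$ and $U=2^m$. Let $X$ be a probability distribution on $\mathbb{R}$; for $n\ge1$, $X^{*n}$ denotes its $n$-fold convolution power (the law of the sum of $n$ i.i.d. $X$-distributed random variables), and $X^{*0}$ is the point mass at $0$. Let $(E,\mathcal{E})$ be a measurable space with a probability measure $\nu$. For each $n\in\{1,2,4,\dots,U/2\}$ let $\theta_n:E\times\mathbb{R}\to\mathbb{R}$ be a measurable function with the following splitting property: whenever $S$ has law $X^{*2n}$ and $C$ has law $\nu$ and is independent of $S$, the random variables $\theta_n(C,S)$ and $S-\theta_n(C,S)$ are independent and each has law $X^{*n}$. Dyadic simulation tree: let $S^0_0$ be a random variable with law $X^{*U}$ and let $C^l_i$ ($0\le l\le m-1$, $0\le i<2^l$) be $E$-valued random variables each with law $\nu$. Define recursively, for $l=0,\dots,m-1$ and $0\le i<2^l$, $S^{l+1}_{2i}=\theta_{U/2^{l+1}}(C^l_i,S^l_i)$ and $S^{l+1}_{2i+1}=S^l_i-S^{l+1}_{2i}$. The underlying random variables are $X_i=S^m_i$ for $0\le i<U$. *)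

theory Defs
  imports "HOL-Probability.Probability"
begin

primrec conv_pow :: "real measure \<Rightarrow> nat \<Rightarrow> real measure" where
  "conv_pow X 0 = return borel 0"
| "conv_pow X (Suc n) = convolution X (conv_pow X n)"

lemma sets_conv_pow [simp, measurable_cong]: "sets (conv_pow X n) = sets borel"
  by (cases n) auto

definition has_law :: "'w measure \<Rightarrow> ('w \<Rightarrow> 'a) \<Rightarrow> 'a measure \<Rightarrow> bool" where
  "has_law M Y \<mu> \<longleftrightarrow> Y \<in> measurable M \<mu> \<and> distr M \<mu> Y = \<mu>"

abbreviation gen_events :: "'w measure \<Rightarrow> ('w \<Rightarrow> 'a) \<Rightarrow> 'a measure \<Rightarrow> 'w set set" where
  "gen_events M Y N \<equiv> sets (vimage_algebra (space M) Y N)"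

text \<open>
  The library's \<open>indep_var\<close> needs both variables to have the same value type, so independence
  of \<open>C\<close> and \<open>S\<close> is stated for the sigma-algebras they generate (to which \<open>indep_var\<close> unfolds).
  The quantifier ranges over probability spaces with sample type \<open>'e \<times> real\<close>, since a
  definition cannot quantify over types; by \<open>splitting_map_transfer\<close> below this gives
  the property on every probability space.
\<close>

definition splitting_map :: "real measure \<Rightarrow> 'e measure \<Rightarrow> nat \<Rightarrow> ('e \<Rightarrow> real \<Rightarrow> real) \<Rightarrow> bool" where
  "splitting_map X \<nu> n \<theta> \<longleftrightarrow>
    (\<forall>(P :: ('e \<times> real) measure) C S.
      prob_space P \<longrightarrow> has_law P S (conv_pow X (2 * n)) \<longrightarrow> has_law P C \<nu> \<longrightarrow>
      prob_space.indep_set P (gen_events P C \<nu>) (gen_events P S borel) \<longrightarrow>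
        prob_space.indep_var P borel (\<lambda>\<omega>. \<theta> (C \<omega>) (S \<omega>)) borel (\<lambda>\<omega>. S \<omega> - \<theta> (C \<omega>) (S \<omega>)) \<and>
        has_law P (\<lambda>\<omega>. \<theta> (C \<omega>) (S \<omega>)) (conv_pow X n) \<and>
        has_law P (\<lambda>\<omega>. S \<omega> - \<theta> (C \<omega>) (S \<omega>)) (conv_pow X n))"

lemma splitting_map_transfer:
  fixes M :: "'w measure" and \<nu> :: "'e measure"
  assumes split: "splitting_map X \<nu> n \<theta>"
    and \<theta>[measurable]: "case_prod \<theta> \<in> borel_measurable (\<nu> \<Otimes>\<^sub>M borel)"
    and M: "prob_space M"
    and S: "has_law M S (conv_pow X (2 * n))" and C: "has_law M C \<nu>"
    and ind: "prob_space.indep_set M (gen_events M C \<nu>) (gen_events M S borel)"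
  shows "prob_space.indep_var M borel (\<lambda>\<omega>. \<theta> (C \<omega>) (S \<omega>)) borel (\<lambda>\<omega>. S \<omega> - \<theta> (C \<omega>) (S \<omega>))"
    and "has_law M (\<lambda>\<omega>. \<theta> (C \<omega>) (S \<omega>)) (conv_pow X n)"
    and "has_law M (\<lambda>\<omega>. S \<omega> - \<theta> (C \<omega>) (S \<omega>)) (conv_pow X n)"
proof -
  interpret M: prob_space M by (rule M)
  have [measurable]: "S \<in> borel_measurable M" "C \<in> measurable M \<nu>"
    using S C by (simp_all add: has_law_def cong: measurable_cong_sets)
  define Q where "Q = distr M (\<nu> \<Otimes>\<^sub>M borel) (\<lambda>\<omega>. (C \<omega>, S \<omega>))"
  interpret Q: prob_space Q unfolding Q_def by (rule M.prob_space_distr) measurable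
  have [simp, measurable_cong]: "sets Q = sets (\<nu> \<Otimes>\<^sub>M borel)" by (simp add: Q_def)
  have push_real: "distr Q N f = distr M N (\<lambda>\<omega>. f (C \<omega>, S \<omega>))"
    if "f \<in> measurable (\<nu> \<Otimes>\<^sub>M borel) N" for f and N :: "real measure"
    using that unfolding Q_def by (subst distr_distr) (auto simp: comp_def)
  have push_e: "distr Q N f = distr M N (\<lambda>\<omega>. f (C \<omega>, S \<omega>))"
    if "f \<in> measurable (\<nu> \<Otimes>\<^sub>M borel) N" for f and N :: "'e measure"
    using that unfolding Q_def by (subst distr_distr) (auto simp: comp_def)
  have push_pair: "distr Q N f = distr M N (\<lambda>\<omega>. f (C \<omega>, S \<omega>))"
    if "f \<in> measurable (\<nu> \<Otimes>\<^sub>M borel) N" for f and N :: "(real \<times> real) measure"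
    using that unfolding Q_def by (subst distr_distr) (auto simp: comp_def)
  have lawS: "has_law Q snd (conv_pow X (2 * n))"
    using S by (auto simp: has_law_def push_real)
  have lawC: "has_law Q fst \<nu>"
    using C by (auto simp: has_law_def push_e)
  have sQ: "space Q = space (\<nu> \<Otimes>\<^sub>M borel)" by (simp add: Q_def)
  have gQ1: "gen_events Q fst \<nu> = {fst -` A \<inter> space Q |A. A \<in> sets \<nu>}"
    by (rule sets_vimage_algebra2) (auto simp: sQ space_pair_measure)
  have gQ2: "gen_events Q snd borel = {snd -` A \<inter> space Q |A. A \<in> sets (borel :: real measure)}"
    by (rule sets_vimage_algebra2) auto
  have indQ: "Q.indep_set (gen_events Q fst \<nu>) (gen_events Q snd borel)"
    unfolding Q.indep_sets2_eq gQ1 gQ2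
  proof (intro conjI ballI; clarify?)
    fix A assume [measurable]: "A \<in> sets \<nu>"
    show "fst -` A \<inter> space Q \<in> Q.events" by measurable
  next
    fix B :: "real set" assume [measurable]: "B \<in> sets borel"
    show "snd -` B \<inter> space Q \<in> Q.events" by measurable
  next
    fix A and B :: "real set" assume [measurable]: "A \<in> sets \<nu>" "B \<in> sets borel"
    have "M.prob ((C -` A \<inter> space M) \<inter> (S -` B \<inter> space M))
        = M.prob (C -` A \<inter> space M) * M.prob (S -` B \<inter> space M)"
      by (rule M.indep_setD[OF ind]) (auto intro: in_vimage_algebra)
    moreover have CS: "(C \<omega>, S \<omega>) \<in> space (\<nu> \<Otimes>\<^sub>M borel)" if "\<omega> \<in> space M" for \<omega>
      using that measurable_space[OF \<open>C \<in> measurable M \<nu>\<close>] by (auto simp: space_pair_measure)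
    have pr: "Q.prob E = M.prob ((\<lambda>\<omega>. (C \<omega>, S \<omega>)) -` E \<inter> space M)"
      if "E \<in> sets (\<nu> \<Otimes>\<^sub>M borel)" for E
      unfolding Q_def by (rule measure_distr) (use that in measurable)
    have "fst -` A \<inter> space Q \<in> Q.events" "snd -` B \<inter> space Q \<in> Q.events" by measurable
    then have ev: "fst -` A \<inter> space Q \<in> sets (\<nu> \<Otimes>\<^sub>M borel)"
      "snd -` B \<inter> space Q \<in> sets (\<nu> \<Otimes>\<^sub>M borel)" by simp_all
    have pre: "(\<lambda>\<omega>. (C \<omega>, S \<omega>)) -` (fst -` A \<inter> space Q) \<inter> space M = C -` A \<inter> space M"
      "(\<lambda>\<omega>. (C \<omega>, S \<omega>)) -` (snd -` B \<inter> space Q) \<inter> space M = S -` B \<inter> space M"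
      "(\<lambda>\<omega>. (C \<omega>, S \<omega>)) -` (fst -` A \<inter> space Q \<inter> (snd -` B \<inter> space Q)) \<inter> space M
        = (C -` A \<inter> space M) \<inter> (S -` B \<inter> space M)"
      using CS by (auto simp: sQ)
    ultimately show "Q.prob (fst -` A \<inter> space Q \<inter> (snd -` B \<inter> space Q))
        = Q.prob (fst -` A \<inter> space Q) * Q.prob (snd -` B \<inter> space Q)"
      by (simp only: pr[OF ev(1)] pr[OF ev(2)] pr[OF sets.Int[OF ev]] pre)
  qed
  note res = split[unfolded splitting_map_def, rule_format, OF Q.prob_space_axioms lawS lawC indQ]
  have [measurable]: "(\<lambda>p. \<theta> (fst p) (snd p)) \<in> borel_measurable (\<nu> \<Otimes>\<^sub>M borel)"
    using \<theta> by (simp add: case_prod_beta')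
  have [measurable]: "(\<lambda>\<omega>. \<theta> (C \<omega>) (S \<omega>)) \<in> borel_measurable M"
    by measurable
  show "has_law M (\<lambda>\<omega>. \<theta> (C \<omega>) (S \<omega>)) (conv_pow X n)"
    using res by (auto simp: has_law_def push_real)
  show "has_law M (\<lambda>\<omega>. S \<omega> - \<theta> (C \<omega>) (S \<omega>)) (conv_pow X n)"
    using res by (auto simp: has_law_def push_real)
  show "M.indep_var borel (\<lambda>\<omega>. \<theta> (C \<omega>) (S \<omega>)) borel (\<lambda>\<omega>. S \<omega> - \<theta> (C \<omega>) (S \<omega>))"
    using res unfolding Q.indep_var_distribution_eq M.indep_var_distribution_eq
    by (auto simp: push_real push_pair)
qed

end

theory Submission
  imports Defs
begin

text \<open>
  Expand the tree level by level, following only the node \<open>p\<close> above the leaf \<open>a\<close> and the node \<open>q\<close>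
  above the leaf \<open>b\<close>. As long as \<open>p < q\<close>, the values at \<open>p\<close> and \<open>q\<close> and the sum of the nodes
  strictly between them are mutually independent with the expected laws. Passing to the next level
  splits only these two nodes, so it involves only the two variables \<open>C\<^sup>l\<^sub>p\<close> and \<open>C\<^sup>l\<^sub>q\<close>:
  pairwise independence within the level and independence from the earlier levels keep the four
  children and the middle sum independent, and the inner children not above \<open>a\<close> or \<open>b\<close> are
  absorbed into the middle sum. At the leaves, \<open>S[a,b)\<close> is the value at \<open>a\<close> plus the middle sum.
\<close>

section \<open>Independence of two random variables whose value types may differ\<close>

definition (in prob_space) indep_rv :: "('a \<Rightarrow> 'b) \<Rightarrow> 'b measure \<Rightarrow> ('a \<Rightarrow> 'c) \<Rightarrow> 'c measure \<Rightarrow> bool" where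
  "indep_rv f N g K \<longleftrightarrow> f \<in> measurable M N \<and> g \<in> measurable M K \<and>
     indep_set (gen_events M f N) (gen_events M g K)"

context prob_space
begin

lemma gen_events_eq:
  "f \<in> measurable M N \<Longrightarrow> gen_events M f N = {f -` A \<inter> space M |A. A \<in> sets N}"
  by (rule sets_vimage_algebra2) (auto dest: measurable_space)

lemma indep_rv_iff:
  "indep_rv f N g K \<longleftrightarrow> f \<in> measurable M N \<and> g \<in> measurable M K \<and>
     (\<forall>A\<in>sets N. \<forall>B\<in>sets K. prob ((f -` A \<inter> space M) \<inter> (g -` B \<inter> space M))
        = prob (f -` A \<inter> space M) * prob (g -` B \<inter> space M))"
proof (cases "f \<in> measurable M N \<and> g \<in> measurable M K")
  case True
  then have f: "f \<in> measurable M N" and g: "g \<in> measurable M K" by auto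
  have "{f -` A \<inter> space M |A. A \<in> sets N} \<subseteq> events" "{g -` B \<inter> space M |B. B \<in> sets K} \<subseteq> events"
    using measurable_sets[OF f] measurable_sets[OF g] by auto
  then show ?thesis
    unfolding indep_rv_def indep_sets2_eq gen_events_eq[OF f] gen_events_eq[OF g] using f g
    by (simp add: Setcompr_eq_image)
qed (auto simp: indep_rv_def)

lemma indep_rv_measurable:
  assumes "indep_rv f N g K"
  shows "f \<in> measurable M N" "g \<in> measurable M K"
  using assms by (auto simp: indep_rv_def)

lemma indep_rvD:
  assumes "indep_rv f N g K" "A \<in> sets N" "B \<in> sets K"
  shows "prob ((f -` A \<inter> space M) \<inter> (g -` B \<inter> space M))
    = prob (f -` A \<inter> space M) * prob (g -` B \<inter> space M)"
  using assms by (auto simp: indep_rv_iff)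

lemma indep_var_iff_indep_rv: "indep_var N f K g \<longleftrightarrow> indep_rv f N g K"
  by (simp add: indep_var_eq indep_rv_def sets_vimage_algebra)

lemma indep_rv_commute: "indep_rv f N g K \<Longrightarrow> indep_rv g K f N"
  by (auto simp: indep_rv_iff Int_commute mult.commute)

lemma indep_rv_compose:
  assumes ind: "indep_rv f N g K"
    and h: "h \<in> measurable N N'" and k: "k \<in> measurable K K'"
    and f': "\<And>\<omega>. \<omega> \<in> space M \<Longrightarrow> f' \<omega> = h (f \<omega>)" and g': "\<And>\<omega>. \<omega> \<in> space M \<Longrightarrow> g' \<omega> = k (g \<omega>)"
  shows "indep_rv f' N' g' K'"
proof -
  note f = indep_rv_measurable(1)[OF ind] and g = indep_rv_measurable(2)[OF ind]
  have "f' \<in> measurable M N'" "g' \<in> measurable M K'"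
    using measurable_compose[OF f h] measurable_compose[OF g k] f' g'
    by (simp_all cong: measurable_cong)
  moreover have f'_vimage: "f' -` A \<inter> space M = f -` (h -` A \<inter> space N) \<inter> space M" for A
    using f' measurable_space[OF f] by auto
  moreover have g'_vimage: "g' -` A \<inter> space M = g -` (k -` A \<inter> space K) \<inter> space M" for A
    using g' measurable_space[OF g] by auto
  ultimately show ?thesis
    unfolding indep_rv_iff f'_vimage g'_vimage
    by (intro conjI ballI indep_rvD[OF ind] measurable_sets[OF h] measurable_sets[OF k])
qed

text \<open>Preimages commute with generating a sigma-algebra, so the rectangles that generate the
  product pull back to a generator. By \<open>Int_stable_rectangles\<close> it is a pi-system, hence
  independence of pairs only has to be checked on rectangles.\<close>

lemma gen_events_Pair:
  assumes f: "f \<in> measurable M N" and g: "g \<in> measurable M K"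
  shows "gen_events M (\<lambda>\<omega>. (f \<omega>, g \<omega>)) (N \<Otimes>\<^sub>M K) = sigma_sets (space M)
    {(f -` A \<inter> space M) \<inter> (g -` B \<inter> space M) |A B. A \<in> sets N \<and> B \<in> sets K}"
proof -
  have fg: "(\<lambda>\<omega>. (f \<omega>, g \<omega>)) \<in> measurable M (N \<Otimes>\<^sub>M K)"
    using f g by simp
  have "gen_events M (\<lambda>\<omega>. (f \<omega>, g \<omega>)) (N \<Otimes>\<^sub>M K) = sigma_sets (space M)
      {(\<lambda>\<omega>. (f \<omega>, g \<omega>)) -` E \<inter> space M |E. E \<in> {A \<times> B |A B. A \<in> sets N \<and> B \<in> sets K}}"
    unfolding gen_events_eq[OF fg] sets_pair_measure
    by (rule sigma_sets_vimage_commute)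
      (use measurable_space[OF f] measurable_space[OF g] in auto)
  also have "{(\<lambda>\<omega>. (f \<omega>, g \<omega>)) -` E \<inter> space M |E. E \<in> {A \<times> B |A B. A \<in> sets N \<and> B \<in> sets K}}
      = {(f -` A \<inter> space M) \<inter> (g -` B \<inter> space M) |A B. A \<in> sets N \<and> B \<in> sets K}"
  proof -
    have "(\<lambda>\<omega>. (f \<omega>, g \<omega>)) -` (A \<times> B) \<inter> space M = (f -` A \<inter> space M) \<inter> (g -` B \<inter> space M)" for A B
      by auto
    then show ?thesis by blast
  qed
  finally show ?thesis .
qed

lemma Int_stable_rectangles:
  "Int_stable {(f -` A \<inter> space M) \<inter> (g -` B \<inter> space M) |A B. A \<in> sets N \<and> B \<in> sets K}"
proof (rule Int_stableI)
  fix P Q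
  assume "P \<in> {(f -` A \<inter> space M) \<inter> (g -` B \<inter> space M) |A B. A \<in> sets N \<and> B \<in> sets K}"
    and "Q \<in> {(f -` A \<inter> space M) \<inter> (g -` B \<inter> space M) |A B. A \<in> sets N \<and> B \<in> sets K}"
  then obtain A B A' B' where *: "A \<in> sets N" "A' \<in> sets N" "B \<in> sets K" "B' \<in> sets K"
    and "P = (f -` A \<inter> space M) \<inter> (g -` B \<inter> space M)" "Q = (f -` A' \<inter> space M) \<inter> (g -` B' \<inter> space M)"
    by blast
  then have "P \<inter> Q = (f -` (A \<inter> A') \<inter> space M) \<inter> (g -` (B \<inter> B') \<inter> space M)" by auto
  with * show "P \<inter> Q \<in> {(f -` A \<inter> space M) \<inter> (g -` B \<inter> space M) |A B. A \<in> sets N \<and> B \<in> sets K}"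
    by blast
qed

text \<open>The three hypotheses together say that \<open>f1\<close>, \<open>f2\<close>,
  \<open>g1\<close>, \<open>g2\<close> are mutually independent, so they may be regrouped. On
  rectangles both sides equal the product of the same four probabilities; the pi-lambda theorem
  extends this to the product sigma-algebras.\<close>

lemma indep_rv_exchange:
  assumes fg: "indep_rv (\<lambda>\<omega>. (f1 \<omega>, f2 \<omega>)) (N1 \<Otimes>\<^sub>M N2) (\<lambda>\<omega>. (g1 \<omega>, g2 \<omega>)) (K1 \<Otimes>\<^sub>M K2)"
    and f: "indep_rv f1 N1 f2 N2" and g: "indep_rv g1 K1 g2 K2"
  shows "indep_rv (\<lambda>\<omega>. (f1 \<omega>, g1 \<omega>)) (N1 \<Otimes>\<^sub>M K1) (\<lambda>\<omega>. (f2 \<omega>, g2 \<omega>)) (N2 \<Otimes>\<^sub>M K2)"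
proof -
  note [measurable] = indep_rv_measurable[OF f] indep_rv_measurable[OF g]
  have 1: "indep_rv f1 N1 g1 K1" "indep_rv f2 N2 g2 K2"
    by (rule indep_rv_compose[OF fg measurable_fst measurable_fst]; simp)
      (rule indep_rv_compose[OF fg measurable_snd measurable_snd]; simp)
  have rect: "prob (((f1 -` A \<inter> space M) \<inter> (g1 -` B \<inter> space M)) \<inter> ((f2 -` A' \<inter> space M) \<inter> (g2 -` B' \<inter> space M)))
      = prob ((f1 -` A \<inter> space M) \<inter> (g1 -` B \<inter> space M)) * prob ((f2 -` A' \<inter> space M) \<inter> (g2 -` B' \<inter> space M))"
    if s: "A \<in> sets N1" "B \<in> sets K1" "A' \<in> sets N2" "B' \<in> sets K2" for A B A' B'
  proof -
    have "(\<lambda>\<omega>. (f1 \<omega>, f2 \<omega>)) -` (A \<times> A') \<inter> space M = (f1 -` A \<inter> space M) \<inter> (f2 -` A' \<inter> space M)"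
      "(\<lambda>\<omega>. (g1 \<omega>, g2 \<omega>)) -` (B \<times> B') \<inter> space M = (g1 -` B \<inter> space M) \<inter> (g2 -` B' \<inter> space M)"
      by auto
    with indep_rvD[OF fg pair_measureI[OF s(1,3)] pair_measureI[OF s(2,4)]]
    have "prob (((f1 -` A \<inter> space M) \<inter> (f2 -` A' \<inter> space M)) \<inter> ((g1 -` B \<inter> space M) \<inter> (g2 -` B' \<inter> space M)))
      = prob ((f1 -` A \<inter> space M) \<inter> (f2 -` A' \<inter> space M)) * prob ((g1 -` B \<inter> space M) \<inter> (g2 -` B' \<inter> space M))"
      by simp
    then show ?thesis
      using indep_rvD[OF f s(1,3)] indep_rvD[OF g s(2,4)] indep_rvD[OF 1(1) s(1,2)]
        indep_rvD[OF 1(2) s(3,4)] by (simp add: ac_simps)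
  qed
  have "indep_set (gen_events M (\<lambda>\<omega>. (f1 \<omega>, g1 \<omega>)) (N1 \<Otimes>\<^sub>M K1)) (gen_events M (\<lambda>\<omega>. (f2 \<omega>, g2 \<omega>)) (N2 \<Otimes>\<^sub>M K2))"
    unfolding gen_events_Pair[OF indep_rv_measurable[OF 1(1)]] gen_events_Pair[OF indep_rv_measurable[OF 1(2)]]
  proof (intro indep_set_sigma_sets Int_stable_rectangles indep_setI)
    show "{(f1 -` A \<inter> space M) \<inter> (g1 -` B \<inter> space M) |A B. A \<in> sets N1 \<and> B \<in> sets K1} \<subseteq> events"
      "{(f2 -` A \<inter> space M) \<inter> (g2 -` B \<inter> space M) |A B. A \<in> sets N2 \<and> B \<in> sets K2} \<subseteq> events"
      using measurable_sets[OF indep_rv_measurable(1)[OF f]] measurable_sets[OF indep_rv_measurable(2)[OF f]]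
        measurable_sets[OF indep_rv_measurable(1)[OF g]] measurable_sets[OF indep_rv_measurable(2)[OF g]]
      by blast+
  qed (use rect in blast)
  then show ?thesis by (simp add: indep_rv_def)
qed

lemma indep_rv_const: "f \<in> measurable M N \<Longrightarrow> c \<in> space K \<Longrightarrow> indep_rv f N (\<lambda>_. c) K"
proof -
  assume "f \<in> measurable M N" "c \<in> space K"
  moreover have "(\<lambda>_. c) -` B \<inter> space M = (if c \<in> B then space M else {})" for B by auto
  ultimately show ?thesis
    by (auto simp: indep_rv_iff prob_space)
qed

text \<open>Mutual independence of three variables is written as two nested pairwise statements
  throughout; this rebrackets them. It is \<open>indep_rv_exchange\<close> with the unit constant as
  a fourth variable.\<close>

lemma indep_rv_assoc:
  assumes fgh: "indep_rv (\<lambda>\<omega>. (f \<omega>, g \<omega>)) (N \<Otimes>\<^sub>M K) h L" and fg: "indep_rv f N g K"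
  shows "indep_rv f N (\<lambda>\<omega>. (g \<omega>, h \<omega>)) (K \<Otimes>\<^sub>M L)"
proof -
  define T where "T = count_space (UNIV :: unit set)"
  note [measurable] = indep_rv_measurable[OF fg] indep_rv_measurable(2)[OF fgh]
  have "indep_rv (\<lambda>\<omega>. (f \<omega>, g \<omega>)) (N \<Otimes>\<^sub>M K) (\<lambda>\<omega>. ((), h \<omega>)) (T \<Otimes>\<^sub>M L)"
    by (rule indep_rv_compose[OF fgh, where h="\<lambda>x. x" and k="Pair ()"]) (auto simp: T_def)
  moreover have "indep_rv (\<lambda>_. ()) T h L"
    by (rule indep_rv_commute, rule indep_rv_const) (auto simp: T_def)
  ultimately have "indep_rv (\<lambda>\<omega>. (f \<omega>, ())) (N \<Otimes>\<^sub>M T) (\<lambda>\<omega>. (g \<omega>, h \<omega>)) (K \<Otimes>\<^sub>M L)"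
    by (intro indep_rv_exchange[OF _ fg])
  then show ?thesis
    by (rule indep_rv_compose[where h=fst and k="\<lambda>x. x"]) auto
qed

text \<open>The opposite rebracketing, obtained by reversing the order of the three variables and
  using symmetry.\<close>

lemma indep_rv_assoc':
  assumes fgh: "indep_rv f N (\<lambda>\<omega>. (g \<omega>, h \<omega>)) (K \<Otimes>\<^sub>M L)" and gh: "indep_rv g K h L"
  shows "indep_rv (\<lambda>\<omega>. (f \<omega>, g \<omega>)) (N \<Otimes>\<^sub>M K) h L"
proof -
  have "indep_rv (\<lambda>\<omega>. (h \<omega>, g \<omega>)) (L \<Otimes>\<^sub>M K) f N"
    by (rule indep_rv_compose[OF indep_rv_commute[OF fgh], where h="\<lambda>(x, y). (y, x)" and k="\<lambda>x. x"])
      auto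
  from indep_rv_assoc[OF this indep_rv_commute[OF gh]]
  show ?thesis
    by (intro indep_rv_compose[OF indep_rv_commute, where h="\<lambda>(x, y). (y, x)" and k="\<lambda>x. x"]) auto
qed

end

section \<open>Convolution powers and laws of sums\<close>

lemma prob_space_conv_pow:
  assumes "real_distribution X"
  shows "prob_space (conv_pow X n)"
proof (induction n)
  case (Suc n)
  interpret X: real_distribution X by fact
  interpret Y: prob_space "conv_pow X n" by fact
  interpret pair_prob_space X "conv_pow X n" ..
  show ?case unfolding conv_pow.simps convolution_def
    by (rule P.prob_space_distr) measurable
qed (simp add: prob_space_return)

lemma conv_pow_add:
  assumes X: "real_distribution X"
  shows "conv_pow X (n + k) = convolution (conv_pow X n) (conv_pow X k)"
proof -
  interpret X: real_distribution X by fact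
  have fin: "finite_measure (conv_pow X j)" for j
    by (rule prob_space.finite_measure[OF prob_space_conv_pow[OF X]])
  show ?thesis
  proof (induction n)
    case 0
    \<comment> \<open>The point mass at 0 is neutral for convolution: integrating against it
      evaluates at \<open>x = 0\<close>.\<close>
    have "emeasure (conv_pow X k) A = emeasure (convolution (return borel 0) (conv_pow X k)) A"
      if "A \<in> sets borel" for A
    proof -
      interpret K: finite_measure "conv_pow X k" by (rule fin)
      have "emeasure (convolution (return borel 0) (conv_pow X k)) A
          = (\<integral>\<^sup>+x. \<integral>\<^sup>+y. indicator A (x + y) \<partial>conv_pow X k \<partial>return borel 0)"
        using that fin[of 0] by (intro convolution_emeasure') (auto intro: fin)
      also have "\<dots> = (\<integral>\<^sup>+y. indicator A (0 + y) \<partial>conv_pow X k)"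
        using that by (intro nn_integral_return) auto
      finally show ?thesis using that by simp
    qed
    then show ?case by (auto intro: measure_eqI)
  next
    case (Suc n)
    then show ?case
      by (simp add: convolution_associative fin X.finite_measure_axioms)
  qed
qed

context prob_space
begin

lemma has_law_conv_pow_add:
  assumes X: "real_distribution X"
    and f: "has_law M f (conv_pow X n)" and g: "has_law M g (conv_pow X k)"
    and ind: "indep_rv f borel g borel"
  shows "has_law M (\<lambda>\<omega>. f \<omega> + g \<omega>) (conv_pow X (n + k))"
proof -
  note [measurable] = indep_rv_measurable[OF ind]
  \<comment> \<open>\<open>has_law\<close> pushes forward to \<open>conv_pow X j\<close>, the rule
    for sums to \<open>borel\<close>; only the sets of the target matter, so both give the same
    law.\<close>
  have d: "distr M (conv_pow X j) h = distr M borel h" for j and h :: "'a \<Rightarrow> real"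
    by (rule distr_cong) auto
  have "distr M borel (\<lambda>\<omega>. f \<omega> + g \<omega>) = convolution (distr M borel f) (distr M borel g)"
    using ind by (intro sum_indep_random_variable) (auto simp: indep_var_iff_indep_rv)
  also have "\<dots> = conv_pow X (n + k)"
    using f g by (simp add: has_law_def d conv_pow_add[OF X])
  finally show ?thesis
    by (simp add: has_law_def d cong: measurable_cong_sets)
qed

lemma has_law_cong:
  assumes "\<And>\<omega>. \<omega> \<in> space M \<Longrightarrow> f \<omega> = g \<omega>"
  shows "has_law M f \<mu> \<longleftrightarrow> has_law M g \<mu>"
  using assms by (simp add: has_law_def cong: measurable_cong distr_cong)

lemma has_law_conv_pow_0: "(\<And>\<omega>. \<omega> \<in> space M \<Longrightarrow> f \<omega> = 0) \<Longrightarrow> has_law M f (conv_pow X 0)"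
proof (subst has_law_cong[where g="\<lambda>_. 0"])
  show "has_law M (\<lambda>_. 0) (conv_pow X 0)"
    unfolding has_law_def conv_pow.simps
    by (auto intro!: measure_eqI simp: emeasure_distr emeasure_space_1 split: split_indicator)
qed auto

lemma has_law_measurable: "has_law M f \<mu> \<Longrightarrow> f \<in> measurable M \<mu>"
  by (simp add: has_law_def)


section \<open>Effect on independence of splitting two nodes and of merging children into the middle
  sum\<close>

lemma indep_rv_absorb_right:
  fixes g l :: "'a \<Rightarrow> real"
  assumes fglr: "indep_rv f N (\<lambda>\<omega>. (g \<omega>, (l \<omega>, r \<omega>))) (borel \<Otimes>\<^sub>M (borel \<Otimes>\<^sub>M R))"
    and glr: "indep_rv g borel (\<lambda>\<omega>. (l \<omega>, r \<omega>)) (borel \<Otimes>\<^sub>M R)"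
    and lr: "indep_rv l borel r R"
    and h: "\<And>\<omega>. \<omega> \<in> space M \<Longrightarrow> h \<omega> = g \<omega> + l \<omega>"
  shows "indep_rv f N (\<lambda>\<omega>. (h \<omega>, r \<omega>)) (borel \<Otimes>\<^sub>M R)" and "indep_rv h borel r R"
proof -
  \<comment> \<open>In the tree, \<open>g\<close> is the middle sum, \<open>l\<close> a left child
    that joins it, and \<open>r\<close> the sibling of \<open>l\<close>, which stays as the right
    boundary node.\<close>
  show "indep_rv f N (\<lambda>\<omega>. (h \<omega>, r \<omega>)) (borel \<Otimes>\<^sub>M R)"
    by (rule indep_rv_compose[OF fglr, where h="\<lambda>x. x" and k="\<lambda>(x, (y, z)). (x + y, z)"]) (auto simp: h)
  show "indep_rv h borel r R"
    by (rule indep_rv_compose[OF indep_rv_assoc'[OF glr lr], where h="\<lambda>(x, y). x + y" and k="\<lambda>x. x"])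
      (auto simp: h)
qed

text \<open>The counterpart at the left boundary: \<open>l\<close> stays as the boundary node and
  its right sibling \<open>r\<close> joins the middle sum \<open>g\<close>. Rebracketing first moves
  \<open>r\<close> over to the side of \<open>g\<close>.\<close>

lemma indep_rv_absorb_left:
  fixes g r :: "'a \<Rightarrow> real"
  assumes lrgf: "indep_rv (\<lambda>\<omega>. (l \<omega>, r \<omega>)) (L \<Otimes>\<^sub>M borel) (\<lambda>\<omega>. (g \<omega>, f \<omega>)) (borel \<Otimes>\<^sub>M N)"
    and lr: "indep_rv l L r borel" and gf: "indep_rv g borel f N"
    and h: "\<And>\<omega>. \<omega> \<in> space M \<Longrightarrow> h \<omega> = r \<omega> + g \<omega>"
  shows "indep_rv l L (\<lambda>\<omega>. (h \<omega>, f \<omega>)) (borel \<Otimes>\<^sub>M N)" and "indep_rv h borel f N"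
proof -
  show "indep_rv l L (\<lambda>\<omega>. (h \<omega>, f \<omega>)) (borel \<Otimes>\<^sub>M N)"
    by (rule indep_rv_compose[OF indep_rv_assoc[OF lrgf lr], where h="\<lambda>x. x" and k="\<lambda>(x, (y, z)). (x + y, z)"])
      (auto simp: h)
  have "indep_rv r borel (\<lambda>\<omega>. (g \<omega>, f \<omega>)) (borel \<Otimes>\<^sub>M N)"
    by (rule indep_rv_compose[OF lrgf, where h=snd and k="\<lambda>x. x"]) auto
  from indep_rv_assoc'[OF this gf] show "indep_rv h borel f N"
    by (rule indep_rv_compose[where h="\<lambda>(x, y). x + y" and k="\<lambda>x. x"]) (auto simp: h)
qed

text \<open>Each coin is brought together with the node it splits: \<open>indep_rv_exchange\<close>
  turns nodes against coins into \<open>(S1, C1)\<close> against \<open>((A, S2), C2)\<close>, and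
  the children are functions of these groups. Siblings remain bundled here; their mutual
  independence needs the splitting property and comes from \<open>split_node\<close>.\<close>

lemma indep_rv_split_pair:
  fixes S1 S2 A :: "'a \<Rightarrow> real" and C1 C2 :: "'a \<Rightarrow> 'e"
  assumes \<theta>[measurable]: "case_prod \<theta> \<in> borel_measurable (\<nu> \<Otimes>\<^sub>M borel)"
    and C: "indep_rv C1 \<nu> C2 \<nu>"
    and S1: "indep_rv S1 borel (\<lambda>\<omega>. (A \<omega>, S2 \<omega>)) (borel \<Otimes>\<^sub>M borel)"
    and S2: "indep_rv A borel S2 borel"
    and SC: "indep_rv (\<lambda>\<omega>. (S1 \<omega>, (A \<omega>, S2 \<omega>))) (borel \<Otimes>\<^sub>M (borel \<Otimes>\<^sub>M borel))
               (\<lambda>\<omega>. (C1 \<omega>, C2 \<omega>)) (\<nu> \<Otimes>\<^sub>M \<nu>)"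
    and L1: "\<And>\<omega>. \<omega> \<in> space M \<Longrightarrow> L1 \<omega> = \<theta> (C1 \<omega>) (S1 \<omega>)"
    and R1: "\<And>\<omega>. \<omega> \<in> space M \<Longrightarrow> R1 \<omega> = S1 \<omega> - L1 \<omega>"
    and L2: "\<And>\<omega>. \<omega> \<in> space M \<Longrightarrow> L2 \<omega> = \<theta> (C2 \<omega>) (S2 \<omega>)"
    and R2: "\<And>\<omega>. \<omega> \<in> space M \<Longrightarrow> R2 \<omega> = S2 \<omega> - L2 \<omega>"
  shows "indep_rv (\<lambda>\<omega>. (L1 \<omega>, R1 \<omega>)) (borel \<Otimes>\<^sub>M borel)
           (\<lambda>\<omega>. (A \<omega>, (L2 \<omega>, R2 \<omega>))) (borel \<Otimes>\<^sub>M (borel \<Otimes>\<^sub>M borel))"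
    and "indep_rv A borel (\<lambda>\<omega>. (L2 \<omega>, R2 \<omega>)) (borel \<Otimes>\<^sub>M borel)"
proof -
  have [measurable]: "(\<lambda>(s, c). \<theta> c s) \<in> borel_measurable (borel \<Otimes>\<^sub>M \<nu>)"
    using measurable_compose[OF measurable_pair_swap' \<theta>] by (simp add: case_prod_beta')
  have sp[measurable]: "(\<lambda>(s, c). (\<theta> c s, s - \<theta> c s)) \<in> (borel \<Otimes>\<^sub>M \<nu>) \<rightarrow>\<^sub>M (borel \<Otimes>\<^sub>M borel)"
    by measurable
  have X: "indep_rv (\<lambda>\<omega>. (S1 \<omega>, C1 \<omega>)) (borel \<Otimes>\<^sub>M \<nu>)
      (\<lambda>\<omega>. ((A \<omega>, S2 \<omega>), C2 \<omega>)) ((borel \<Otimes>\<^sub>M borel) \<Otimes>\<^sub>M \<nu>)"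
    by (rule indep_rv_exchange[OF SC S1 C])
  show "indep_rv (\<lambda>\<omega>. (L1 \<omega>, R1 \<omega>)) (borel \<Otimes>\<^sub>M borel)
           (\<lambda>\<omega>. (A \<omega>, (L2 \<omega>, R2 \<omega>))) (borel \<Otimes>\<^sub>M (borel \<Otimes>\<^sub>M borel))"
  proof (rule indep_rv_compose[OF X sp])
    show "(\<lambda>z. (fst (fst z), (\<lambda>(s, c). (\<theta> c s, s - \<theta> c s)) (snd (fst z), snd z)))
        \<in> (borel \<Otimes>\<^sub>M borel) \<Otimes>\<^sub>M \<nu> \<rightarrow>\<^sub>M borel \<Otimes>\<^sub>M (borel \<Otimes>\<^sub>M borel)"
      by (intro measurable_Pair measurable_compose[OF _ sp]) measurable
  qed (simp_all add: L1 R1 L2 R2)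
  have "indep_rv (\<lambda>\<omega>. (A \<omega>, S2 \<omega>)) (borel \<Otimes>\<^sub>M borel) C2 \<nu>"
    by (rule indep_rv_compose[OF SC, where h=snd and k=snd]) auto
  from indep_rv_assoc[OF this S2]
  show "indep_rv A borel (\<lambda>\<omega>. (L2 \<omega>, R2 \<omega>)) (borel \<Otimes>\<^sub>M borel)"
    by (rule indep_rv_compose[OF _ _ sp, where h="\<lambda>x. x"]) (auto simp: L2 R2)
qed

end

section \<open>The dyadic tree, its filtration and the coins of a level\<close>

locale dyadic_tree = prob_space M for M :: "'w measure" +
  fixes m :: nat and X :: "real measure" and \<nu> :: "'e measure"
    and \<theta> :: "nat \<Rightarrow> 'e \<Rightarrow> real \<Rightarrow> real"
    and S :: "nat \<Rightarrow> nat \<Rightarrow> 'w \<Rightarrow> real" and C :: "nat \<Rightarrow> nat \<Rightarrow> 'w \<Rightarrow> 'e"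
  assumes X: "real_distribution X"
    and \<theta>_measurable: "\<And>k. k < m \<Longrightarrow> case_prod (\<theta> (2 ^ k)) \<in> borel_measurable (\<nu> \<Otimes>\<^sub>M borel)"
    and \<theta>_splitting: "\<And>k. k < m \<Longrightarrow> splitting_map X \<nu> (2 ^ k) (\<theta> (2 ^ k))"
    and law_root: "has_law M (S 0 0) (conv_pow X (2 ^ m))"
    and law_C: "\<And>l i. l < m \<Longrightarrow> i < 2 ^ l \<Longrightarrow> has_law M (C l i) \<nu>"
    and S_left: "\<And>l i \<omega>. l < m \<Longrightarrow> i < 2 ^ l \<Longrightarrow> \<omega> \<in> space M \<Longrightarrow>
           S (Suc l) (2 * i) \<omega> = \<theta> (2 ^ (m - Suc l)) (C l i \<omega>) (S l i \<omega>)"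
    and S_right: "\<And>l i \<omega>. l < m \<Longrightarrow> i < 2 ^ l \<Longrightarrow> \<omega> \<in> space M \<Longrightarrow>
           S (Suc l) (Suc (2 * i)) \<omega> = S l i \<omega> - S (Suc l) (2 * i) \<omega>"
    and indep_levels: "indep_sets
           (\<lambda>k. case k of
               0 \<Rightarrow> gen_events M (S 0 0) borel
             | Suc l \<Rightarrow> gen_events M (\<lambda>\<omega>. \<lambda>i\<in>{..<2 ^ l}. C l i \<omega>) (Pi\<^sub>M {..<2 ^ l} (\<lambda>_. \<nu>)))
           {0..m}"
    and pairwise_C: "\<And>l. l < m \<Longrightarrow> pairwise (\<lambda>i j. indep_var \<nu> (C l i) \<nu> (C l j)) {..<2 ^ l}"
begin

text \<open>Index 0 stands for the root and index \<open>Suc l\<close> for the coins of level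
  \<open>l\<close>, that is, for the randomness that first enters at the nodes of level
  \<open>Suc l\<close>.\<close>

definition level_events :: "nat \<Rightarrow> 'w set set" where
  "level_events k = (case k of
               0 \<Rightarrow> gen_events M (S 0 0) borel
             | Suc l \<Rightarrow> gen_events M (\<lambda>\<omega>. \<lambda>i\<in>{..<2 ^ l}. C l i \<omega>) (Pi\<^sub>M {..<2 ^ l} (\<lambda>_. \<nu>)))"

text \<open>The natural filtration: it is generated by the root and the coins of all levels below
  \<open>l\<close>. The encoding as a measure lets \<open>measurable\<close> express
  adaptedness.\<close>

definition past :: "nat \<Rightarrow> 'w measure" where
  "past l = sigma (space M) (\<Union>k\<in>{0..l}. level_events k)"

lemma level_events_subset: "level_events k \<subseteq> Pow (space M)"
  unfolding level_events_def
  by (cases k) (simp_all, (metis sets.space_closed space_vimage_algebra)+)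

lemma space_past [simp]: "space (past l) = space M"
  using level_events_subset by (auto simp: past_def intro!: space_measure_of)

lemma sets_past: "sets (past l) = sigma_sets (space M) (\<Union>k\<in>{0..l}. level_events k)"
  unfolding past_def using level_events_subset by (intro sets_measure_of) auto

lemma past_mono: "l \<le> l' \<Longrightarrow> sets (past l) \<subseteq> sets (past l')"
  unfolding sets_past by (intro sigma_sets_mono') force

lemma measurable_past_mono: "f \<in> measurable (past l) N \<Longrightarrow> l \<le> l' \<Longrightarrow> f \<in> measurable (past l') N"
  using past_mono[of l l'] by (auto simp: measurable_def)

lemma C_measurable: "l < m \<Longrightarrow> i < 2 ^ l \<Longrightarrow> C l i \<in> measurable M \<nu>"
  using law_C has_law_measurable by blast

text \<open>The joint sigma-algebra of all coins of level \<open>l\<close>, as a measure for the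
  same reason as \<open>past\<close>.\<close>

definition coins :: "nat \<Rightarrow> 'w measure" where
  "coins l = vimage_algebra (space M) (\<lambda>\<omega>. \<lambda>i\<in>{..<2 ^ l}. C l i \<omega>) (Pi\<^sub>M {..<2 ^ l} (\<lambda>_. \<nu>))"

lemma space_coins [simp]: "space (coins l) = space M"
  by (simp add: coins_def)

lemma sets_coins: "sets (coins l) = level_events (Suc l)"
  by (simp add: coins_def level_events_def)

lemma C_measurable_coins:
  assumes "l < m" "i < 2 ^ l"
  shows "C l i \<in> measurable (coins l) \<nu>"
proof -
  have "(\<lambda>\<omega>. \<lambda>i\<in>{..<2 ^ l}. C l i \<omega>) \<in> measurable (coins l) (Pi\<^sub>M {..<2 ^ l} (\<lambda>_. \<nu>))"
    unfolding coins_def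
    by (rule measurable_vimage_algebra1)
      (use assms(1) measurable_space[OF C_measurable] in \<open>auto simp: space_PiM\<close>)
  then have "(\<lambda>\<omega>. (\<lambda>i\<in>{..<2 ^ l}. C l i \<omega>) i) \<in> measurable (coins l) \<nu>"
    by (rule measurable_compose) (use assms in \<open>auto intro: measurable_component_singleton\<close>)
  then show ?thesis using assms by simp
qed

lemma C_measurable_past:
  assumes "l < m" "i < 2 ^ l"
  shows "C l i \<in> measurable (past (Suc l)) \<nu>"
proof -
  have "sets (coins l) \<subseteq> sets (past (Suc l))"
    unfolding sets_coins sets_past by (intro subsetI sigma_sets.Basic UN_I[of "Suc l"]) auto
  then show ?thesis
    using C_measurable_coins[OF assms] by (auto simp: measurable_def)
qed

text \<open>Unfolding the recursion, a node of level \<open>l\<close> is a measurable function of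
  the root and the coins on the path above it, all from levels below \<open>l\<close>.\<close>

lemma S_measurable_past: "l \<le> m \<Longrightarrow> i < 2 ^ l \<Longrightarrow> S l i \<in> borel_measurable (past l)"
proof (induction l arbitrary: i)
  case 0
  have "S 0 0 \<in> borel_measurable (vimage_algebra (space M) (S 0 0) borel)"
    by (rule measurable_vimage_algebra1) auto
  moreover have "gen_events M (S 0 0) borel \<subseteq> sets (past 0)"
    unfolding sets_past by (auto simp: level_events_def intro: sigma_sets.Basic)
  ultimately show ?case using 0 by (auto simp: measurable_def)
next
  case (Suc l)
  \<comment> \<open>The parent of node \<open>i\<close> is \<open>i div 2\<close>; its left child
    has the even index, its right child the odd one.\<close>
  have i: "i div 2 < 2 ^ l" using Suc.prems by auto
  have [measurable]: "S l (i div 2) \<in> borel_measurable (past (Suc l))"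
    using Suc.IH[OF _ i] Suc.prems by (auto intro: measurable_past_mono)
  have [measurable]: "C l (i div 2) \<in> measurable (past (Suc l)) \<nu>"
    using C_measurable_past i Suc.prems by auto
  have [measurable]: "case_prod (\<theta> (2 ^ (m - Suc l))) \<in> borel_measurable (\<nu> \<Otimes>\<^sub>M borel)"
    using \<theta>_measurable Suc.prems by auto
  have "(\<lambda>\<omega>. \<theta> (2 ^ (m - Suc l)) (C l (i div 2) \<omega>) (S l (i div 2) \<omega>)) \<in> borel_measurable (past (Suc l))"
    by measurable
  then have L: "S (Suc l) (2 * (i div 2)) \<in> borel_measurable (past (Suc l))"
    using S_left[of l "i div 2"] i Suc.prems by (subst measurable_cong) auto
  then have "(\<lambda>\<omega>. S l (i div 2) \<omega> - S (Suc l) (2 * (i div 2)) \<omega>) \<in> borel_measurable (past (Suc l))"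
    by measurable
  then have R: "S (Suc l) (Suc (2 * (i div 2))) \<in> borel_measurable (past (Suc l))"
    using S_right[of l "i div 2"] i Suc.prems by (subst measurable_cong) auto
  show ?case
  proof (cases "even i")
    case True with L show ?thesis by simp
  next
    case False with R show ?thesis by (simp add: odd_two_times_div_two_succ)
  qed
qed

text \<open>Grouping independent sigma-algebras into disjoint blocks of indices, here
  \<open>{0..l}\<close> and \<open>{Suc l}\<close>, preserves independence. The blocks are indexed
  by \<open>bool\<close>, as \<open>indep_set\<close> is a family over \<open>bool\<close>.\<close>

lemma indep_past_coins:
  assumes l: "l < m"
  shows "indep_set (sets (past l)) (sets (coins l))"
proof -
  let ?I = "case_bool {0..l} {Suc l}"
  have "indep_sets (\<lambda>j. sigma_sets (space M) (\<Union>i\<in>?I j. level_events i)) UNIV"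
  proof (rule indep_sets_collect_sigma)
    show "indep_sets level_events (\<Union>j. ?I j)"
      using indep_levels unfolding level_events_def
      by (rule indep_sets_mono_index[rotated]) (use l in \<open>auto split: bool.splits\<close>)
    show "Int_stable (level_events i)" for i
      by (auto simp: Int_stable_def level_events_def split: nat.splits)
    show "disjoint_family ?I"
      by (auto simp: disjoint_family_on_def split: bool.splits)
  qed
  moreover have "sigma_sets (space M) (level_events (Suc l)) = sets (coins l)"
    using sets.sigma_sets_eq[of "coins l"] by (simp add: sets_coins)
  ultimately show ?thesis
    unfolding indep_set_def by (elim indep_sets_mono_sets) (auto simp: sets_past split: bool.splits)
qed

lemma indep_rv_past_coins:
  assumes l: "l < m" and f: "f \<in> measurable (past l) N" and g: "g \<in> measurable (coins l) K"
  shows "indep_rv f N g K"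
proof -
  note ind = indep_past_coins[OF l]
  have "sets (past l) \<subseteq> events" "sets (coins l) \<subseteq> events"
    using indep_setD_ev1[OF ind] indep_setD_ev2[OF ind] by auto
  then have "f \<in> measurable M N" "g \<in> measurable M K"
    using f g by (auto simp: measurable_def)
  moreover have "prob ((f -` A \<inter> space M) \<inter> (g -` B \<inter> space M))
      = prob (f -` A \<inter> space M) * prob (g -` B \<inter> space M)" if "A \<in> sets N" "B \<in> sets K" for A B
    using indep_setD[OF ind] measurable_sets[OF f that(1)] measurable_sets[OF g that(2)] by simp
  ultimately show ?thesis by (simp add: indep_rv_iff)
qed

section \<open>Laws and independence along the two boundary paths, by induction on the level\<close>

definition mid :: "nat \<Rightarrow> nat \<Rightarrow> nat \<Rightarrow> 'w \<Rightarrow> real" where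
  "mid l p q \<omega> = (\<Sum>i\<in>{Suc p..<q}. S l i \<omega>)"

text \<open>The two children of each node add up to it. For \<open>p > q\<close> both sums are
  empty.\<close>

lemma sum_children:
  assumes "l < m" "q \<le> 2 ^ l" "\<omega> \<in> space M"
  shows "(\<Sum>i\<in>{2 * p..<2 * q}. S (Suc l) i \<omega>) = (\<Sum>i\<in>{p..<q}. S l i \<omega>)"
proof (cases "p \<le> q")
  case True
  then show ?thesis using assms(2)
  proof (induction q rule: dec_induct)
    case (step q)
    then show ?case
      using S_right[of l q \<omega>] assms(1,3) by simp
  qed simp
qed simp

text \<open>The node depends on \<open>past l\<close> and its coin on \<open>coins l\<close>, so
  they are independent and the splitting property, transferred to \<open>M\<close>, applies.\<close>

lemma split_node:
  assumes l: "l < m" and p: "p < 2 ^ l" and law: "has_law M (S l p) (conv_pow X (2 ^ (m - l)))"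
  shows "indep_rv (S (Suc l) (2 * p)) borel (S (Suc l) (Suc (2 * p))) borel"
    and "has_law M (S (Suc l) (2 * p)) (conv_pow X (2 ^ (m - Suc l)))"
    and "has_law M (S (Suc l) (Suc (2 * p))) (conv_pow X (2 ^ (m - Suc l)))"
proof -
  let ?n = "2 ^ (m - Suc l) :: nat"
  have n: "2 ^ (m - l) = 2 * ?n" using l by (simp flip: power_Suc add: Suc_diff_Suc)
  have k: "m - Suc l < m" using l by simp
  have ind: "indep_rv (C l p) \<nu> (S l p) borel"
    by (intro indep_rv_commute[OF indep_rv_past_coins[OF l S_measurable_past C_measurable_coins]])
      (use l p in auto)
  note * = splitting_map_transfer[OF \<theta>_splitting[OF k] \<theta>_measurable[OF k] prob_space_axioms
      law[unfolded n] law_C[OF l p] ind[unfolded indep_rv_def, THEN conjunct2, THEN conjunct2]]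
  have L: "S (Suc l) (2 * p) \<omega> = \<theta> ?n (C l p \<omega>) (S l p \<omega>)"
    and R: "S (Suc l) (Suc (2 * p)) \<omega> = S l p \<omega> - \<theta> ?n (C l p \<omega>) (S l p \<omega>)"
    if "\<omega> \<in> space M" for \<omega>
    by (simp_all only: S_left[OF l p that] S_right[OF l p that])
  show "has_law M (S (Suc l) (2 * p)) (conv_pow X ?n)" "has_law M (S (Suc l) (Suc (2 * p))) (conv_pow X ?n)"
    using *(2,3) by (simp_all add: has_law_cong[OF L] has_law_cong[OF R])
  show "indep_rv (S (Suc l) (2 * p)) borel (S (Suc l) (Suc (2 * p))) borel"
    by (rule indep_rv_compose[OF *(1)[unfolded indep_var_iff_indep_rv], where h="\<lambda>x. x" and k="\<lambda>x. x"])
      (simp_all only: L R measurable_ident_sets)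
qed

lemma law_node: "l \<le> m \<Longrightarrow> p < 2 ^ l \<Longrightarrow> has_law M (S l p) (conv_pow X (2 ^ (m - l)))"
proof (induction l arbitrary: p)
  case 0
  then show ?case using law_root by simp
next
  case (Suc l)
  have l: "l < m" and p: "p div 2 < 2 ^ l" using Suc.prems by auto
  note * = split_node(2,3)[OF l p Suc.IH[OF less_imp_le[OF l] p]]
  show ?case
  proof (cases "even p")
    case True with * show ?thesis by simp
  next
    case False with * show ?thesis by (simp add: odd_two_times_div_two_succ)
  qed
qed

text \<open>The induction invariant. Its first two conjuncts encode mutual independence of three
  variables; in the third, \<open>q - Suc p\<close> nodes of weight \<open>2 ^ (m - l)\<close> each
  lie strictly between. Level 0 has a single node, so the base case is vacuous.\<close>

lemma indep_node_mid_node: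
  "l \<le> m \<Longrightarrow> p < q \<Longrightarrow> q < 2 ^ l \<Longrightarrow>
    indep_rv (S l p) borel (\<lambda>\<omega>. (mid l p q \<omega>, S l q \<omega>)) (borel \<Otimes>\<^sub>M borel) \<and>
    indep_rv (mid l p q) borel (S l q) borel \<and>
    has_law M (mid l p q) (conv_pow X ((q - Suc p) * 2 ^ (m - l)))"
proof (induction l arbitrary: p q)
  case 0
  then show ?case by simp
next
  case (Suc l p' q')
  \<comment> \<open>The parents of the two boundary nodes at the new level.\<close>
  define p q where "p = p' div 2" and "q = q' div 2"
  define n where "n = (2::nat) ^ (m - Suc l)"
  have l: "l < m" and q: "q < 2 ^ l" and p: "p < 2 ^ l" and "p \<le> q"
    using Suc.prems by (auto simp: p_def q_def)
  have n2: "2 ^ (m - l) = 2 * n" using l by (simp flip: power_Suc add: Suc_diff_Suc n_def)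
  note law = law_node[OF less_imp_le[OF l]]
  note splitp = split_node[OF l p law[OF p], folded n_def]
    and splitq = split_node[OF l q law[OF q], folded n_def]
  have p': "p' = 2 * p \<or> p' = Suc (2 * p)" and q': "q' = 2 * q \<or> q' = Suc (2 * q)"
    by (auto simp: p_def q_def)
  show ?case
  proof (cases "p = q")
    \<comment> \<open>With a common parent, the two nodes are siblings and the middle sum is empty,
      so \<open>split_node\<close> suffices.\<close>
    case True
    with p' q' \<open>p' < q'\<close> have e: "p' = 2 * p" "q' = Suc (2 * p)" by auto
    have 0: "mid (Suc l) p' q' = (\<lambda>_. 0)" by (auto simp: mid_def e)
    have "indep_rv (S (Suc l) p') borel (\<lambda>\<omega>. (0, S (Suc l) q' \<omega>)) (borel \<Otimes>\<^sub>M borel)"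
      unfolding e by (rule indep_rv_compose[OF splitp(1), where h="\<lambda>x. x" and k="Pair 0"]) auto
    moreover have "indep_rv (\<lambda>_. 0::real) borel (S (Suc l) q') borel"
      unfolding e by (rule indep_rv_compose[OF splitp(1), where h="\<lambda>_. 0" and k="\<lambda>x. x"]) auto
    moreover have "has_law M (\<lambda>_. 0) (conv_pow X 0)"
      by (rule has_law_conv_pow_0) simp
    ultimately show ?thesis by (simp add: 0[unfolded e] e)
  next
    case False
    with \<open>p \<le> q\<close> have pq: "p < q" by simp
    define L1 R1 L2 R2 where "L1 = S (Suc l) (2 * p)" and "R1 = S (Suc l) (Suc (2 * p))"
      and "L2 = S (Suc l) (2 * q)" and "R2 = S (Suc l) (Suc (2 * q))"
    note defs = L1_def R1_def L2_def R2_def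
    have IH1: "indep_rv (S l p) borel (\<lambda>\<omega>. (mid l p q \<omega>, S l q \<omega>)) (borel \<Otimes>\<^sub>M borel)"
      and IH2: "indep_rv (mid l p q) borel (S l q) borel"
      and IH3: "has_law M (mid l p q) (conv_pow X ((q - Suc p) * 2 ^ (m - l)))"
      using Suc.IH[OF less_imp_le[OF l] pq q] by auto
    have [measurable]: "S l i \<in> borel_measurable (past l)" if "i < 2 ^ l" for i
      using l that by (intro S_measurable_past) auto
    have [measurable]: "S l p \<in> borel_measurable (past l)" "S l q \<in> borel_measurable (past l)"
      using p q by auto
    have [measurable]: "mid l p q \<in> borel_measurable (past l)"
      unfolding mid_def[abs_def] using q by (intro borel_measurable_sum) auto
    \<comment> \<open>All three values belong to the past of level \<open>l\<close>, so they are
      jointly independent of the two fresh coins.\<close>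
    have SC: "indep_rv (\<lambda>\<omega>. (S l p \<omega>, (mid l p q \<omega>, S l q \<omega>))) (borel \<Otimes>\<^sub>M (borel \<Otimes>\<^sub>M borel))
        (\<lambda>\<omega>. (C l p \<omega>, C l q \<omega>)) (\<nu> \<Otimes>\<^sub>M \<nu>)"
      using C_measurable_coins[OF l p] C_measurable_coins[OF l q] by (intro indep_rv_past_coins[OF l]) auto
    \<comment> \<open>Only two coins of this level are involved, and \<open>p < q\<close> makes them
      distinct: pairwise independence is exactly enough.\<close>
    have CC: "indep_rv (C l p) \<nu> (C l q) \<nu>"
      using pairwise_C[OF l] p q pq by (auto simp: pairwise_def indep_var_iff_indep_rv)
    have "m - Suc l < m" using l by simp
    note D = indep_rv_split_pair[OF \<theta>_measurable[OF this] CC IH1 IH2 SC S_left[OF l p] S_right[OF l p]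
        S_left[OF l q] S_right[OF l q], folded defs]
    \<comment> \<open>The children of the nodes strictly between \<open>p\<close> and
      \<open>q\<close> are exactly the nodes strictly between the right child of \<open>p\<close>
      and the left child of \<open>q\<close>.\<close>
    have mid: "mid l p q \<omega> = mid (Suc l) (Suc (2 * p)) (2 * q) \<omega>" if "\<omega> \<in> space M" for \<omega>
      using sum_children[OF l less_imp_le[OF q] that, of "Suc p"] by (simp add: mid_def)
    \<comment> \<open>The two ends are settled one after the other. \<open>?A\<close> starts after
      the right child of \<open>p\<close>, so \<open>L1\<close> and \<open>R1\<close> stay bundled
      while the right end is adjusted to \<open>q'\<close>.\<close>
    let ?A = "mid (Suc l) (Suc (2 * p)) q'" and ?Y = "S (Suc l) q'"
    have A: "indep_rv (\<lambda>\<omega>. (L1 \<omega>, R1 \<omega>)) (borel \<Otimes>\<^sub>M borel) (\<lambda>\<omega>. (?A \<omega>, ?Y \<omega>)) (borel \<Otimes>\<^sub>M borel) \<and>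
        indep_rv ?A borel ?Y borel \<and> has_law M ?A (conv_pow X ((q' - Suc (Suc (2 * p))) * n))"
      using q'
    proof
      \<comment> \<open>The right child \<open>R2\<close> lies beyond the new boundary and is
        discarded; the middle sum keeps its value.\<close>
      assume e: "q' = 2 * q"
      have "indep_rv (\<lambda>\<omega>. (L1 \<omega>, R1 \<omega>)) (borel \<Otimes>\<^sub>M borel) (\<lambda>\<omega>. (?A \<omega>, ?Y \<omega>)) (borel \<Otimes>\<^sub>M borel)"
        by (rule indep_rv_compose[OF D(1), where h="\<lambda>x. x" and k="\<lambda>(x, (y, z)). (x, y)"])
          (auto simp: e mid L2_def)
      moreover have "indep_rv ?A borel ?Y borel"
        by (rule indep_rv_compose[OF D(2), where h="\<lambda>x. x" and k="fst"])
          (auto simp: e mid L2_def)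
      moreover have "(q - Suc p) * 2 ^ (m - l) = (q' - Suc (Suc (2 * p))) * n"
        by (simp add: n2 e diff_mult_distrib)
      then have "has_law M ?A (conv_pow X ((q' - Suc (Suc (2 * p))) * n))"
        using IH3 has_law_cong[OF mid] by (simp add: e)
      ultimately show ?thesis by blast
    next
      \<comment> \<open>The left child \<open>L2\<close> now lies inside and is absorbed into the
        middle sum, adding \<open>n\<close> to the exponent.\<close>
      assume e: "q' = Suc (2 * q)"
      have A: "?A \<omega> = mid l p q \<omega> + L2 \<omega>" if "\<omega> \<in> space M" for \<omega>
        using mid[OF that] pq by (simp add: e mid_def L2_def)
      note lr = splitq(1)[folded defs]
      have "indep_rv (mid l p q) borel L2 borel"
        by (rule indep_rv_compose[OF D(2), where h="\<lambda>x. x" and k="fst"]) auto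
      from has_law_conv_pow_add[OF X IH3 splitq(2)[folded defs] this]
      have "has_law M ?A (conv_pow X ((q - Suc p) * 2 ^ (m - l) + n))"
        by (simp add: has_law_cong[OF A])
      moreover have "(q - Suc p) * 2 ^ (m - l) + n = (q' - Suc (Suc (2 * p))) * n"
      proof -
        \<comment> \<open>Naming the number of nodes in between removes the truncated
          subtraction.\<close>
        obtain d where "q = Suc p + d" using pq by (metis Suc_leI le_Suc_ex)
        then show ?thesis by (simp add: n2 e algebra_simps)
      qed
      ultimately show ?thesis
        using indep_rv_absorb_right[OF D lr A] by (simp add: e R2_def)
    qed
    note A1 = A[THEN conjunct1] and A2 = A[THEN conjunct2, THEN conjunct1]
      and A3 = A[THEN conjunct2, THEN conjunct2]
    show ?thesis
      using p'
    proof
      \<comment> \<open>The left child \<open>L1\<close> lies outside the boundary and is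
        discarded.\<close>
      assume e: "p' = Suc (2 * p)"
      have "indep_rv R1 borel (\<lambda>\<omega>. (?A \<omega>, ?Y \<omega>)) (borel \<Otimes>\<^sub>M borel)"
        by (rule indep_rv_compose[OF A1, where h=snd and k="\<lambda>x. x"]) auto
      with A2 A3 show ?thesis by (simp add: e R1_def n_def)
    next
      \<comment> \<open>The right child \<open>R1\<close> lies inside and joins the middle
        sum.\<close>
      assume e: "p' = 2 * p"
      have B: "mid (Suc l) p' q' \<omega> = R1 \<omega> + ?A \<omega>" for \<omega>
      proof -
        have "Suc (2 * p) < q'" using pq q' by auto
        then show ?thesis
          unfolding mid_def e R1_def by (rule sum.atLeast_Suc_lessThan)
      qed
      have "indep_rv R1 borel ?A borel"
        by (rule indep_rv_compose[OF A1, where h=snd and k=fst]) auto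
      from has_law_conv_pow_add[OF X splitp(3)[folded defs] A3 this]
      have "has_law M (mid (Suc l) p' q') (conv_pow X (n + (q' - Suc (Suc (2 * p))) * n))"
        by (simp add: has_law_cong[OF B])
      moreover have "n + (q' - Suc (Suc (2 * p))) * n = (q' - Suc p') * n"
      proof -
        have "q' - Suc p' = Suc (q' - Suc (Suc (2 * p)))" using e pq q' by auto
        then show ?thesis by simp
      qed
      ultimately show ?thesis
        using indep_rv_absorb_left[OF A1 splitp(1)[folded defs] A2 B] by (simp add: e L1_def n_def)
    qed
  qed
qed

text \<open>Since \<open>b < 2 ^ m\<close>, the excluded endpoint \<open>b\<close> is itself a leaf
  and can serve as the right boundary node of the invariant. The case \<open>a = b\<close> is
  separate because the invariant requires \<open>p < q\<close>.\<close>

lemma law_range_sum: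
  assumes "a \<le> b" "b < 2 ^ m"
  shows "has_law M (\<lambda>\<omega>. \<Sum>i\<in>{a..<b}. S m i \<omega>) (conv_pow X (b - a))"
proof (cases "a = b")
  case True
  then show ?thesis using has_law_conv_pow_0 by simp
next
  case False
  with assms have ab: "a < b" by simp
  note * = indep_node_mid_node[OF order_refl ab assms(2)]
  have "indep_rv (S m a) borel (mid m a b) borel"
    by (rule indep_rv_compose[OF *[THEN conjunct1], where h="\<lambda>x. x" and k=fst]) auto
  \<comment> \<open>At level \<open>m\<close> every node has weight \<open>2 ^ 0 = 1\<close>, so the
    exponents add up to \<open>1 + (b - Suc a) = b - a\<close>.\<close>
  from has_law_conv_pow_add[OF X law_node _ this, of "b - Suc a"] * ab assms
  have "has_law M (\<lambda>\<omega>. S m a \<omega> + mid m a b \<omega>) (conv_pow X (b - a))"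
    by (simp add: Suc_diff_Suc)
  then show ?thesis using ab by (simp add: mid_def sum.atLeast_Suc_lessThan)
qed

end

theorem theorem9:
  fixes m U :: nat
    and X :: "real measure"
    and \<nu> :: "'e measure"
    and \<theta> :: "nat \<Rightarrow> 'e \<Rightarrow> real \<Rightarrow> real"
    and M :: "'w measure"
    and S :: "nat \<Rightarrow> nat \<Rightarrow> 'w \<Rightarrow> real"
    and C :: "nat \<Rightarrow> nat \<Rightarrow> 'w \<Rightarrow> 'e"
    and a b :: nat
  assumes "m \<ge> 1" and "U = 2 ^ m"
    and "real_distribution X"
    and "prob_space \<nu>"
    and "\<And>n. n \<in> {2 ^ k |k. k < m} \<Longrightarrow> case_prod (\<theta> n) \<in> borel_measurable (\<nu> \<Otimes>\<^sub>M borel)"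
    and "\<And>n. n \<in> {2 ^ k |k. k < m} \<Longrightarrow> splitting_map X \<nu> n (\<theta> n)"
    and "prob_space M"
    and "has_law M (S 0 0) (conv_pow X U)"
    and "\<And>l i. l < m \<Longrightarrow> i < 2 ^ l \<Longrightarrow> has_law M (C l i) \<nu>"
    and "\<And>l i \<omega>. l < m \<Longrightarrow> i < 2 ^ l \<Longrightarrow> \<omega> \<in> space M \<Longrightarrow>
           S (l + 1) (2 * i) \<omega> = \<theta> (U div 2 ^ (l + 1)) (C l i \<omega>) (S l i \<omega>)"
    and "\<And>l i \<omega>. l < m \<Longrightarrow> i < 2 ^ l \<Longrightarrow> \<omega> \<in> space M \<Longrightarrow>
           S (l + 1) (2 * i + 1) \<omega> = S l i \<omega> - S (l + 1) (2 * i) \<omega>"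
    and "prob_space.indep_sets M
           (\<lambda>k. case k of
               0 \<Rightarrow> gen_events M (S 0 0) borel
             | Suc l \<Rightarrow> gen_events M (\<lambda>\<omega>. \<lambda>i\<in>{..<2 ^ l}. C l i \<omega>) (Pi\<^sub>M {..<2 ^ l} (\<lambda>_. \<nu>)))
           {0..m}"
    and "\<And>l. l < m \<Longrightarrow>
           pairwise (\<lambda>i j. prob_space.indep_var M \<nu> (C l i) \<nu> (C l j)) {..<2 ^ l}"
    and "a \<le> b" and "b < U"
  shows "has_law M (\<lambda>\<omega>. \<Sum>i\<in>{a..<b}. S m i \<omega>) (conv_pow X (b - a))"
proof -
  interpret prob_space M by fact
  \<comment> \<open>The locale indexes the splitting maps by powers of two with explicit exponents;
    this translates the quotients of \<open>U\<close> into that form.\<close>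
  have div: "U div 2 ^ Suc l = 2 ^ (m - Suc l)" if "l < m" for l
    using that \<open>U = 2 ^ m\<close> by (simp add: power_diff del: power_Suc)
  interpret dyadic_tree M m X \<nu> \<theta> S C
  proof (intro dyadic_tree.intro dyadic_tree_axioms.intro)
    fix l i :: nat and \<omega> assume *: "l < m" "i < 2 ^ l" "\<omega> \<in> space M"
    show "S (Suc l) (2 * i) \<omega> = \<theta> (2 ^ (m - Suc l)) (C l i \<omega>) (S l i \<omega>)"
      using assms(10)[OF *] div[OF *(1)] by simp
    show "S (Suc l) (Suc (2 * i)) \<omega> = S l i \<omega> - S (Suc l) (2 * i) \<omega>"
      using assms(11)[OF *] by simp
  next
    fix k :: nat assume "k < m"
    then have "2 ^ k \<in> {2 ^ k |k. k < m}" by blast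
    then show "case_prod (\<theta> (2 ^ k)) \<in> borel_measurable (\<nu> \<Otimes>\<^sub>M borel)"
      and "splitting_map X \<nu> (2 ^ k) (\<theta> (2 ^ k))"
      by (fact assms(5), fact assms(6))
  qed (fact assms(7) assms(3) assms(8)[unfolded assms(2)] assms(9,12,13))+
  show ?thesis
    using law_range_sum assms by simp
qed

end
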